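(* Let $Y$ be a locally compact $\sigma$-compact Hausdorff space and $q:Y\to X$ a pure quotient map with $X$ Hausdorff. Then $q$ is locally closed at $x\in X$ if and only if $x$ is a $k$-point of $X$.
   Context: A map $q:Y\to X$ is locally closed at $x\in X$ if for every closed set $W\subseteq Y$, $x\in\overline{q(W)}$ implies $x\in q(W)$. A point $x$ of a topological space $X$ is a $k$-point if whenever $E\subseteq X$ and $x\in\overline E$, there is a compact set $K\subseteq X$ such that $x\in\overline{E\cap K}$. A net in $Y$ converges to $\infty$ if it is eventually outside every compact subset of $Y$. A quotient map $q:Y\to X$ (with $Y$ locally compact $\sigma$-compact Hausdorff, $X$ Hausdorff) is pure if there is a subset $D\subseteq Y$ such that (i) $D$ is dense in $Y$ and $q|_D$ is injective, and (ii) for every net $(d_\alpha)$ in $D$ with $d_\alpha\to\infty$, every net $(e_\alpha)$ in $Y$ (with the same index set) satisfying $q(e_\alpha)=q(d_\alpha)$ for all $\alpha$ also satisfies $e_\alpha\to\infty$. *)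

theory Defs
  imports "HOL-Analysis.Analysis"
begin

definition sigma_compact_space :: "'a topology \<Rightarrow> bool" where
  "sigma_compact_space Y \<longleftrightarrow>
     (\<exists>\<K>. countable \<K> \<and> (\<forall>K\<in>\<K>. compactin Y K) \<and> \<Union>\<K> = topspace Y)"

definition locally_closed_at :: "'a topology \<Rightarrow> 'b topology \<Rightarrow> ('a \<Rightarrow> 'b) \<Rightarrow> 'b \<Rightarrow> bool" where
  "locally_closed_at Y X q x \<longleftrightarrow>
     (\<forall>W. closedin Y W \<longrightarrow> x \<in> X closure_of (q ` W) \<longrightarrow> x \<in> q ` W)"

definition k_point :: "'b topology \<Rightarrow> 'b \<Rightarrow> bool" where
  "k_point X x \<longleftrightarrow> x \<in> topspace X \<and>
     (\<forall>E. E \<subseteq> topspace X \<longrightarrow> x \<in> X closure_of E \<longrightarrow>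
        (\<exists>K. compactin X K \<and> x \<in> X closure_of (E \<inter> K)))"

definition directed_index_set :: "'i set \<Rightarrow> ('i \<Rightarrow> 'i \<Rightarrow> bool) \<Rightarrow> bool" where
  "directed_index_set I le \<longleftrightarrow>
     I \<noteq> {} \<and> reflp_on I le \<and> transp_on I le \<and>
     (\<forall>i\<in>I. \<forall>j\<in>I. \<exists>k\<in>I. le i k \<and> le j k)"

definition net_to_infinity ::
    "'a topology \<Rightarrow> 'i set \<Rightarrow> ('i \<Rightarrow> 'i \<Rightarrow> bool) \<Rightarrow> ('i \<Rightarrow> 'a) \<Rightarrow> bool" where
  "net_to_infinity Y I le y \<longleftrightarrow>
     (\<forall>K. compactin Y K \<longrightarrow> (\<exists>i\<in>I. \<forall>j\<in>I. le i j \<longrightarrow> y j \<notin> K))"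

text \<open>
  HOL cannot quantify over the type of the indices inside a definition. The nets below are
  indexed by arbitrary directed subsets of the type \<open>'a set\<close>, where \<open>'a\<close> is the type
  of the points of \<open>Y\<close>. This is no restriction: by lemma \<open>pure_quotient_map_nets\<close>
  the condition then holds for nets indexed by directed sets of any type.
\<close>

definition pure_quotient_map :: "'a topology \<Rightarrow> 'b topology \<Rightarrow> ('a \<Rightarrow> 'b) \<Rightarrow> bool" where
  "pure_quotient_map Y X q \<longleftrightarrow>
     quotient_map Y X q \<and>
     (\<exists>D. D \<subseteq> topspace Y \<and> Y closure_of D = topspace Y \<and> inj_on q D \<and>
        (\<forall>(I :: 'a set set) le d e.
           directed_index_set I le \<longrightarrow>
           (\<forall>i\<in>I. d i \<in> D) \<longrightarrow> net_to_infinity Y I le d \<longrightarrow>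
           (\<forall>i\<in>I. e i \<in> topspace Y) \<longrightarrow> (\<forall>i\<in>I. q (e i) = q (d i)) \<longrightarrow>
           net_to_infinity Y I le e))"

lemma net_condition_any_index_type:
  fixes I :: "'i set" and d e :: "'i \<Rightarrow> 'a"
  assumes nets: "\<And>(J :: 'a set set) le d e.
      \<lbrakk>directed_index_set J le; \<forall>i\<in>J. d i \<in> D; net_to_infinity Y J le d;
       \<forall>i\<in>J. e i \<in> topspace Y; \<forall>i\<in>J. q (e i) = q (d i)\<rbrakk> \<Longrightarrow> net_to_infinity Y J le e"
    and I: "directed_index_set I le"
    and d: "\<forall>i\<in>I. d i \<in> D" "net_to_infinity Y I le d"
    and e: "\<forall>i\<in>I. e i \<in> topspace Y" "\<forall>i\<in>I. q (e i) = q (d i)"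
  shows "net_to_infinity Y I le e"
proof (rule ccontr)
  assume "\<not> net_to_infinity Y I le e"
  then obtain K where K: "compactin Y K" and
    freq: "\<And>i. i \<in> I \<Longrightarrow> \<exists>j\<in>I. le i j \<and> e j \<in> K"
    unfolding net_to_infinity_def by blast
  have "\<exists>j\<in>I. d j \<notin> C \<and> e j \<in> K" if "compactin Y C" for C
    using d(2) that freq unfolding net_to_infinity_def by meson
  then obtain f where f: "\<And>C. compactin Y C \<Longrightarrow> f C \<in> I \<and> d (f C) \<notin> C \<and> e (f C) \<in> K"
    by metis
  let ?J = "{C. compactin Y C}"
  have "\<exists>C\<in>?J. A \<subseteq> C \<and> B \<subseteq> C" if "A \<in> ?J" "B \<in> ?J" for A B
    using that compactin_Un[of Y A B] by (intro bexI[of _ "A \<union> B"]) auto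
  moreover have "{} \<in> ?J"
    by simp
  ultimately have J: "directed_index_set ?J (\<subseteq>)"
    unfolding directed_index_set_def by (auto intro!: reflp_onI transp_onI)
  have dJ: "net_to_infinity Y ?J (\<subseteq>) (d \<circ> f)"
    unfolding net_to_infinity_def
  proof (intro allI impI)
    fix C assume "compactin Y C"
    then show "\<exists>i\<in>?J. \<forall>j\<in>?J. i \<subseteq> j \<longrightarrow> (d \<circ> f) j \<notin> C"
      using f by (intro bexI[of _ C]) auto
  qed
  have "net_to_infinity Y ?J (\<subseteq>) (e \<circ> f)"
    by (rule nets[OF J _ dJ]) (use f d(1) e in auto)
  then show False
    using K f unfolding net_to_infinity_def by fastforce
qed

lemma pure_quotient_map_nets:
  assumes "pure_quotient_map Y X q"
  obtains D where "D \<subseteq> topspace Y" "Y closure_of D = topspace Y" "inj_on q D"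
    "\<And>(I :: 'i set) le d e.
      \<lbrakk>directed_index_set I le; \<forall>i\<in>I. d i \<in> D; net_to_infinity Y I le d;
       \<forall>i\<in>I. e i \<in> topspace Y; \<forall>i\<in>I. q (e i) = q (d i)\<rbrakk> \<Longrightarrow> net_to_infinity Y I le e"
proof -
  obtain D where D: "D \<subseteq> topspace Y" "Y closure_of D = topspace Y" "inj_on q D"
    and nets: "\<And>(J :: 'a set set) le d e.
      \<lbrakk>directed_index_set J le; \<forall>i\<in>J. d i \<in> D; net_to_infinity Y J le d;
       \<forall>i\<in>J. e i \<in> topspace Y; \<forall>i\<in>J. q (e i) = q (d i)\<rbrakk> \<Longrightarrow> net_to_infinity Y J le e"
    using assms unfolding pure_quotient_map_def by metis
  show thesis
    by (rule that[OF D]) (rule net_condition_any_index_type[where q = q, OF nets])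
qed

end

(*
  If q is locally closed at x, and x is in the closure of E, then x = q y for some y in the
  closure of the preimage of E, and the image of a compact neighbourhood of y is the compact set
  that the k-point property asks for.

  Conversely, let x be a k-point and W a closed set with x in the closure of q(W) but not in q(W).
  By normality, W has an open neighbourhood V whose closure misses the fibre of x. Since D is
  dense, x is in the closure of E = q(D \<inter> V), hence in the closure of E \<inter> K for some compact K.
  Every compact subset of X is covered by the image of a compact subset of Y, so purity confines the
  points of D over K to one compact set C. So x lies in the compact set q(C \<inter> closure V),
  which is a contradiction.
*)
theory Submission
  imports Defs
begin

text \<open>Sigma-compactness enters below through the Lindelof property, which gives both the
  exhaustion by compact sets and the normality of \<open>Y\<close>.\<close>

lemma sigma_compact_imp_Lindelof_space:
  assumes "sigma_compact_space Y"
  shows "Lindelof_space Y"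
proof -
  obtain \<K> where \<K>: "countable \<K>" "\<And>K. K \<in> \<K> \<Longrightarrow> compactin Y K" "\<Union>\<K> = topspace Y"
    using assms unfolding sigma_compact_space_def by metis
  have "Lindelof_space (subtopology Y (\<Union>\<K>))"
  proof (rule Lindelof_space_Union[OF \<K>(1)])
    show "Lindelof_space (subtopology Y K)" if "K \<in> \<K>" for K
      using \<K>(2)[OF that] by (intro compact_imp_Lindelof_space compact_space_subtopology)
  qed
  then show ?thesis
    by (simp add: \<K>(3))
qed

text \<open>A countable subcover by open sets with compact supersets supplies \<open>U\<close>;
  finite unions of those supersets make \<open>C\<close> increasing, while \<open>U\<close> itself
  need not increase.\<close>

lemma locally_compact_Lindelof_exhaustion:
  assumes "locally_compact_space Y" and "Lindelof_space Y"
  obtains U C :: "nat \<Rightarrow> 'a set" where "\<And>n. openin Y (U n)" "\<And>n. compactin Y (C n)"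
    "\<And>n. U n \<subseteq> C n" "incseq C" "topspace Y = (\<Union>n. U n)"
proof -
  define \<U> where "\<U> = {U. openin Y U \<and> (\<exists>C. compactin Y C \<and> U \<subseteq> C)}"
  have "topspace Y \<subseteq> \<Union>\<U>"
    using assms(1) unfolding locally_compact_space_def \<U>_def by fast
  then obtain \<V> where \<V>: "countable \<V>" "\<V> \<subseteq> \<U>" "topspace Y \<subseteq> \<Union>\<V>"
    using assms(2) unfolding Lindelof_space_alt \<U>_def by (metis (no_types, lifting) mem_Collect_eq)
  \<comment> \<open>Adjoining the empty set makes the family nonempty, so it can be enumerated by
    the naturals even if the subcover is empty.\<close>
  have "{} \<in> \<U>"
    unfolding \<U>_def by auto
  then obtain V :: "nat \<Rightarrow> 'a set" where V: "range V = insert {} \<V>" "\<And>n. V n \<in> \<U>"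
    using \<V> by (metis countable_insert insert_not_empty insert_subset range_from_nat_into
        range_subsetD uncountable_def)
  have "\<exists>C. compactin Y C \<and> V n \<subseteq> C" for n
    using V(2)[of n] by (auto simp: \<U>_def)
  then obtain C where C: "\<And>n. compactin Y (C n)" "\<And>n. V n \<subseteq> C n"
    by metis
  show thesis
  proof
    show "openin Y (V n)" for n
      using V(2)[of n] by (simp add: \<U>_def)
    show "compactin Y (\<Union>i\<le>n. C i)" for n
      using C(1) by (auto intro: compactin_Union)
    show "V n \<subseteq> (\<Union>i\<le>n. C i)" for n
      using C(2) by blast
    show "incseq (\<lambda>n. \<Union>i\<le>n. C i)"
      by (intro monoI UN_mono) auto
    show "topspace Y = (\<Union>n. V n)"
      using \<V>(3) V \<U>_def openin_subset by fastforce
  qed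
qed

text \<open>Otherwise \<open>K\<close> contains a sequence with \<open>f n\<close> outside
  \<open>q\<close> C n\<open>. Only finitely many indices fall into each\<close>q
  \<open>C n\<close>, so the tails of the sequence are closed in the quotient topology, and their
  complements \<open>G n\<close> form an open cover of \<open>K\<close> without a finite
  subcover.\<close>

lemma compactin_subset_quotient_image:
  assumes lc: "locally_compact_space Y" and lin: "Lindelof_space Y"
    and haus: "Hausdorff_space X" and q: "quotient_map Y X q" and K: "compactin X K"
  obtains C where "compactin Y C" "K \<subseteq> q ` C"
proof (rule ccontr)
  assume "\<not> thesis"
  with that have none: "\<And>C. compactin Y C \<Longrightarrow> \<not> K \<subseteq> q ` C"
    by blast
  obtain U C :: "nat \<Rightarrow> 'a set" where U: "\<And>n. openin Y (U n)" "topspace Y = (\<Union>n. U n)"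
    and C: "\<And>n. compactin Y (C n)" "\<And>n. U n \<subseteq> C n" "incseq C"
    by (rule locally_compact_Lindelof_exhaustion[OF lc lin]) blast
  obtain f where f: "\<And>n. f n \<in> K" "\<And>n. f n \<notin> q ` C n"
    using none[OF C(1)] unfolding subset_iff by metis
  have fX: "range f \<subseteq> topspace X"
    using f(1) K compactin_subset_topspace by blast
  have tail: "m < n" if "f m \<in> q ` C n" for m n
    using that f(2)[of m] monoD[OF C(3), of n m] by (meson image_mono not_le subsetD)
  define G where "G n = topspace X - f ` {n..}" for n
  have "openin X (G n)" for n
  proof -
    have fin: "closedin X (f ` {n..<m})" for m
      using haus fX by (intro closedin_Hausdorff_finite) auto
    \<comment> \<open>This is the preimage of \<open>G n\<close>: a point of \<open>U m\<close> can
      only be mapped to terms of index below \<open>m\<close>, so on \<open>U m\<close> removing the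
      fibres of finitely many terms removes those of the whole tail.\<close>
    have "openin Y (\<Union>m. U m - {y \<in> topspace Y. q y \<in> f ` {n..<m}})"
      using U(1) fin closedin_continuous_map_preimage[OF quotient_imp_continuous_map[OF q]]
      by (intro openin_Union) (auto intro!: openin_diff)
    also have "(\<Union>m. U m - {y \<in> topspace Y. q y \<in> f ` {n..<m}})
        = {y \<in> topspace Y. q y \<in> G n}"
    proof (intro equalityI subsetI)
      fix y assume "y \<in> (\<Union>m. U m - {y \<in> topspace Y. q y \<in> f ` {n..<m}})"
      then obtain m where m: "y \<in> U m" "q y \<notin> f ` {n..<m}" and y: "y \<in> topspace Y"
        using U(2) by blast
      have "q y \<noteq> f k" if "k \<ge> n" for k
      proof
        assume k: "q y = f k"
        have "q y \<in> q ` C m"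
          using m(1) C(2) by blast
        then have "k < m"
          unfolding k by (rule tail)
        then show False
          using m(2) k that by auto
      qed
      then show "y \<in> {y \<in> topspace Y. q y \<in> G n}"
        using y quotient_imp_surjective_map[OF q] by (auto simp: G_def)
    next
      fix y assume "y \<in> {y \<in> topspace Y. q y \<in> G n}"
      then show "y \<in> (\<Union>m. U m - {y \<in> topspace Y. q y \<in> f ` {n..<m}})"
        using U(2) by (auto simp: G_def)
    qed
    finally show ?thesis
      using q unfolding quotient_map_def G_def by blast
  qed
  moreover have "K \<subseteq> (\<Union>n. G n)"
  proof
    fix z assume "z \<in> K"
    then have "z \<in> topspace X"
      using K compactin_subset_topspace by blast
    then obtain n where "z \<in> q ` C n"
      using quotient_imp_surjective_map[OF q] U(2) C(2) by blast
    then have "z \<notin> f ` {n..}"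
      using tail by (metis atLeast_iff imageE not_le)
    then show "z \<in> (\<Union>n. G n)"
      using \<open>z \<in> topspace X\<close> by (auto simp: G_def)
  qed
  ultimately obtain \<F> where \<F>: "finite \<F>" "\<F> \<subseteq> range G" "K \<subseteq> \<Union>\<F>"
    using compactinD[OF K, of "range G"] by blast
  then obtain N where N: "finite N" "\<F> = G ` N"
    by (meson finite_subset_image)
  \<comment> \<open>A term of such a late index lies in every tail that starts at an element of
    \<open>N\<close>. Inserting 0 keeps the maximum meaningful for empty \<open>N\<close>.\<close>
  have "f (Max (insert 0 N)) \<in> (\<Union>n\<in>N. G n)"
    using f(1) \<F>(3) N(2) by blast
  then obtain n where "n \<in> N" "f (Max (insert 0 N)) \<notin> f ` {n..}"
    by (auto simp: G_def)
  moreover have "n \<le> Max (insert 0 N)"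
    using N(1) \<open>n \<in> N\<close> by simp
  ultimately show False
    by simp
qed

lemma locally_closed_at_imp_k_point:
  assumes lc: "locally_compact_space Y" and q: "quotient_map Y X q" and "x \<in> topspace X"
    and closed: "locally_closed_at Y X q x"
  shows "k_point X x"
  unfolding k_point_def
proof (intro conjI allI impI)
  fix E assume E: "E \<subseteq> topspace X" and x: "x \<in> X closure_of E"
  define P where "P = {y \<in> topspace Y. q y \<in> E}"
  note cont = quotient_imp_continuous_map[OF q]
  have "P \<subseteq> Y closure_of P"
    by (rule closure_of_subset) (auto simp: P_def)
  moreover have "E = q ` P"
    using E quotient_imp_surjective_map[OF q] by (auto simp: P_def)
  \<comment> \<open>\<open>P\<close> need not be closed, so local closedness is applied to its
    closure, whose image contains \<open>E\<close>.\<close>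
  ultimately have "x \<in> X closure_of (q ` (Y closure_of P))"
    using x closure_of_mono[of E "q ` (Y closure_of P)" X] by blast
  then have "x \<in> q ` (Y closure_of P)"
    using closed unfolding locally_closed_at_def by simp
  then obtain y where y: "y \<in> Y closure_of P" "x = q y"
    by blast
  then obtain U C where U: "openin Y U" "y \<in> U" "U \<subseteq> C" and C: "compactin Y C"
    using lc closure_of_subset_topspace unfolding locally_compact_space_def by (metis subsetD)
  have "y \<in> Y closure_of (U \<inter> P)"
    using openin_Int_closure_of_subset[OF U(1)] y(1) U(2) by blast
  then have "x \<in> X closure_of (q ` (U \<inter> P))"
    using continuous_map_image_closure_subset[OF cont] y(2) by blast
  moreover have "q ` (U \<inter> P) \<subseteq> E \<inter> q ` C"
    using U(3) by (auto simp: P_def)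
  ultimately have "x \<in> X closure_of (E \<inter> q ` C)"
    using closure_of_mono by blast
  then show "\<exists>K. compactin X K \<and> x \<in> X closure_of (E \<inter> K)"
    using image_compactin[OF C cont] by blast
qed fact

text \<open>This is purity restated without nets. If no compact \<open>C\<close> works, pick for
  each one a point of \<open>D\<close> outside \<open>C\<close> whose fibre meets \<open>K\<close>.
  Indexed by the compact sets under inclusion, these points tend to infinity, while their partners
  stay in \<open>K\<close>.\<close>

lemma pure_quotient_map_compact_saturation:
  assumes "pure_quotient_map Y X q"
  obtains D where "D \<subseteq> topspace Y" "Y closure_of D = topspace Y"
    "\<And>K. compactin Y K \<Longrightarrow> \<exists>C. compactin Y C \<and> {d \<in> D. q d \<in> q ` K} \<subseteq> C"
proof -
  obtain D where D: "D \<subseteq> topspace Y" "Y closure_of D = topspace Y"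
    and nets: "\<And>(I :: 'a set set) le d e.
      \<lbrakk>directed_index_set I le; \<forall>i\<in>I. d i \<in> D; net_to_infinity Y I le d;
       \<forall>i\<in>I. e i \<in> topspace Y; \<forall>i\<in>I. q (e i) = q (d i)\<rbrakk> \<Longrightarrow> net_to_infinity Y I le e"
    using assms unfolding pure_quotient_map_def by metis
  have "\<exists>C. compactin Y C \<and> {d \<in> D. q d \<in> q ` K} \<subseteq> C" if K: "compactin Y K" for K
  proof (rule ccontr)
    assume "\<not> ?thesis"
    then have "\<forall>C. compactin Y C \<longrightarrow> (\<exists>d e. d \<in> D \<and> d \<notin> C \<and> e \<in> K \<and> q e = q d)"
      by (smt (verit) imageE mem_Collect_eq subsetI)
    then obtain d e where de: "\<And>C. compactin Y C \<Longrightarrow> d C \<in> D \<and> d C \<notin> C \<and> e C \<in> K \<and> q (e C) = q (d C)"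
      by metis
    let ?I = "{C. compactin Y C}"
    have "\<exists>C\<in>?I. A \<subseteq> C \<and> B \<subseteq> C" if "A \<in> ?I" "B \<in> ?I" for A B
      using that compactin_Un[of Y A B] by (intro bexI[of _ "A \<union> B"]) auto
    moreover have "{} \<in> ?I"
      by simp
    ultimately have I: "directed_index_set ?I (\<subseteq>)"
      unfolding directed_index_set_def by (auto intro!: reflp_onI transp_onI)
    have "net_to_infinity Y ?I (\<subseteq>) d"
      unfolding net_to_infinity_def
    proof (intro allI impI)
      fix C assume "compactin Y C"
      then show "\<exists>i\<in>?I. \<forall>j\<in>?I. i \<subseteq> j \<longrightarrow> d j \<notin> C"
        using de by (intro bexI[of _ C]) auto
    qed
    then have "net_to_infinity Y ?I (\<subseteq>) e"
      by (rule nets[OF I, rotated])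
        (use de compactin_subset_topspace[OF K] in auto)
    then show False
      using K de unfolding net_to_infinity_def by fastforce
  qed
  with D show thesis
    by (rule that)
qed

lemma k_point_imp_locally_closed_at:
  assumes lc: "locally_compact_space Y" and lin: "Lindelof_space Y" and hausY: "Hausdorff_space Y"
    and hausX: "Hausdorff_space X" and pure: "pure_quotient_map Y X q" and k: "k_point X x"
  shows "locally_closed_at Y X q x"
  unfolding locally_closed_at_def
proof (intro allI impI)
  fix W assume W: "closedin Y W" and xW: "x \<in> X closure_of (q ` W)"
  obtain D where D: "D \<subseteq> topspace Y" "Y closure_of D = topspace Y"
    and sat: "\<And>K. compactin Y K \<Longrightarrow> \<exists>C. compactin Y C \<and> {d \<in> D. q d \<in> q ` K} \<subseteq> C"
    by (rule pure_quotient_map_compact_saturation[OF pure]) blast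
  have q: "quotient_map Y X q"
    using pure unfolding pure_quotient_map_def by blast
  note cont = quotient_imp_continuous_map[OF q]
  have normal: "normal_space Y"
    using lc lin hausY
    by (intro regular_Lindelof_imp_normal_space locally_compact_Hausdorff_imp_regular_space)
  have xX: "x \<in> topspace X"
    using k unfolding k_point_def by blast
  show "x \<in> q ` W"
  proof (rule ccontr)
    assume x: "x \<notin> q ` W"
    \<comment> \<open>The fibre of \<open>x\<close> is closed because points of \<open>X\<close> are
      closed; normality then separates it from \<open>W\<close>.\<close>
    define F where "F = {y \<in> topspace Y. q y \<in> {x}}"
    have "closedin Y F"
      unfolding F_def
      using closedin_continuous_map_preimage[OF cont closedin_Hausdorff_singleton[OF hausX xX]] .
    moreover have "disjnt W F"
      using x by (auto simp: F_def disjnt_def)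
    ultimately obtain V where V: "openin Y V" "W \<subseteq> V" "disjnt F (Y closure_of V)"
      using normal W unfolding normal_space by metis
    \<comment> \<open>Density of \<open>D\<close> allows the open set \<open>V\<close> to be
      replaced by \<open>V \<inter> D\<close>, to which purity applies.\<close>
    have "V \<subseteq> Y closure_of (V \<inter> D)"
      using openin_Int_closure_of_subset[OF V(1), of D] D(2) openin_subset[OF V(1)] by auto
    then have "q ` W \<subseteq> X closure_of (q ` (V \<inter> D))"
      using V(2) continuous_map_image_closure_subset[OF cont, of "V \<inter> D"] by blast
    then have "x \<in> X closure_of (q ` (V \<inter> D))"
      using xW closure_of_minimal[OF _ closedin_closure_of] by (meson subsetD)
    moreover have "q ` (V \<inter> D) \<subseteq> topspace X"
      using D(1) quotient_imp_surjective_map[OF q] by blast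
    ultimately obtain K where K: "compactin X K" "x \<in> X closure_of (q ` (V \<inter> D) \<inter> K)"
      using k unfolding k_point_def by blast
    obtain L where L: "compactin Y L" "K \<subseteq> q ` L"
      by (rule compactin_subset_quotient_image[OF lc lin hausX q K(1)])
    obtain C where C: "compactin Y C" "{d \<in> D. q d \<in> q ` L} \<subseteq> C"
      using sat[OF L(1)] by blast
    have "compactin Y (C \<inter> Y closure_of V)"
      using C(1) by (simp add: compact_Int_closedin)
    then have "closedin X (q ` (C \<inter> Y closure_of V))"
      using compactin_imp_closedin[OF hausX] image_compactin[OF _ cont] by blast
    \<comment> \<open>A point of \<open>D\<close> over \<open>K\<close> shares its fibre with a
      point of \<open>L\<close>, hence lies in \<open>C\<close>.\<close>
    moreover have "q ` (V \<inter> D) \<inter> K \<subseteq> q ` (C \<inter> Y closure_of V)"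
      using L(2) C(2) closure_of_subset[OF openin_subset[OF V(1)]] by blast
    ultimately have "x \<in> q ` (C \<inter> Y closure_of V)"
      using K(2) closure_of_minimal by (meson subsetD)
    then show False
      using V(3) closure_of_subset_topspace[of Y V] by (auto simp: F_def disjnt_def)
  qed
qed

theorem theorem4p1:
  fixes Y :: "'a topology" and X :: "'b topology" and q :: "'a \<Rightarrow> 'b" and x :: 'b
  assumes "locally_compact_space Y" and "sigma_compact_space Y" and "Hausdorff_space Y"
    and "Hausdorff_space X"
    and "pure_quotient_map Y X q"
    and "x \<in> topspace X"
  shows "locally_closed_at Y X q x \<longleftrightarrow> k_point X x"
proof
  assume "locally_closed_at Y X q x"
  then show "k_point X x"
    using assms(1,5,6) by (intro locally_closed_at_imp_k_point) (simp_all add: pure_quotient_map_def)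
next
  assume "k_point X x"
  then show "locally_closed_at Y X q x"
    using assms(1-5) by (intro k_point_imp_locally_closed_at sigma_compact_imp_Lindelof_space)
qed

end
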